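(* Let $R$ be a commutative Noetherian ring of finite Krull dimension and let $M$ be a finitely generated $R$-module. Let $f\colon M\to M$ be an $R$-linear endomorphism that factors as a composition of $R$-linear maps $M\to N\to M$ for some finitely generated $R$-module $N$ with $\operatorname{Ass}(M)\cap\operatorname{Ass}(N)=\emptyset$. Then $f$ is nilpotent.
   Context: $\operatorname{Ass}(M)$ is the set of associated primes of $M$, i.e. the prime ideals of $R$ of the form $\operatorname{Ann}_R(a)$ with $a\in M$. *)

theory Defs
  imports
    "HOL-Algebra.Module"
    "HOL-Algebra.Ring_Divisibility"
    "HOL-Library.Extended_Nat"
begin

definition ann :: "('a, 'r) ring_scheme \<Rightarrow> ('a, 'b, 'm) module_scheme \<Rightarrow> 'b \<Rightarrow> 'a set"
  where "ann R M x = {r \<in> carrier R. r \<odot>\<^bsub>M\<^esub> x = \<zero>\<^bsub>M\<^esub>}"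

definition Ass :: "('a, 'r) ring_scheme \<Rightarrow> ('a, 'b, 'm) module_scheme \<Rightarrow> 'a set set"
  where "Ass R M = {P. primeideal P R \<and> (\<exists>a \<in> carrier M. P = ann R M a)}"

text \<open>Submodule generated by a subset, in the style of \<^const>\<open>genideal\<close>.\<close>

definition gen_submodule ::
    "('a, 'r) ring_scheme \<Rightarrow> ('a, 'b, 'm) module_scheme \<Rightarrow> 'b set \<Rightarrow> 'b set"
  where "gen_submodule R M S = \<Inter>{H. submodule H R M \<and> S \<subseteq> H}"

definition fin_gen :: "('a, 'r) ring_scheme \<Rightarrow> ('a, 'b, 'm) module_scheme \<Rightarrow> bool"
  where "fin_gen R M \<longleftrightarrow>
    (\<exists>S. finite S \<and> S \<subseteq> carrier M \<and> gen_submodule R M S = carrier M)"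

definition lin_maps ::
    "('a, 'r) ring_scheme \<Rightarrow> ('a, 'b, 'm) module_scheme \<Rightarrow> ('a, 'c, 'n) module_scheme
      \<Rightarrow> ('b \<Rightarrow> 'c) set"
  where "lin_maps R M N =
    {h \<in> hom (add_monoid M) (add_monoid N).
      \<forall>r \<in> carrier R. \<forall>x \<in> carrier M. h (r \<odot>\<^bsub>M\<^esub> x) = r \<odot>\<^bsub>N\<^esub> h x}"

text \<open>Supremum of the lengths \<open>n\<close> of chains \<open>P 0 \<subset> \<dots> \<subset> P n\<close> of prime ideals. The zero ring,
  which has no prime ideals, gets the value \<open>0\<close> instead of \<open>-\<infinity>\<close>.\<close>

definition krull_dim :: "('a, 'r) ring_scheme \<Rightarrow> enat"
  where "krull_dim R =
    Sup {enat n | n. \<exists>P. (\<forall>i \<le> n. primeideal (P i) R) \<and> (\<forall>i < n. P i \<subset> P (Suc i))}"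

text \<open>Maps are compared on the carrier only: \<open>f\<close> is nilpotent if some power of it is the zero map
  there.\<close>

definition nilpotent_on :: "('a, 'b, 'm) module_scheme \<Rightarrow> ('b \<Rightarrow> 'b) \<Rightarrow> bool"
  where "nilpotent_on M f \<longleftrightarrow> (\<exists>n. \<forall>x \<in> carrier M. (f ^^ n) x = \<zero>\<^bsub>M\<^esub>)"

end

(* If f is not nilpotent then, M being finitely generated, the set Z of all z in M with
   f^k z \<noteq> 0 for every k is nonempty. Choose z in Z with P = Ann z maximal. As f z lies in Z and
   Ann z \<subseteq> Ann (f z), maximality gives Ann (f^k z) = P for all k, from which P is seen to be prime.
   Since Ann z \<subseteq> Ann (g z) \<subseteq> Ann (h (g z)) = Ann (f z), P is associated to both M and N. *)

theory Submission
  imports Defs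
begin

text \<open>Zorn's lemma applies because in a Noetherian ring a nonempty chain of ideals has its
  union among its members, so the upper bound stays in \<open>A\<close>.\<close>

lemma (in noetherian_ring) ideals_have_maximal:
  assumes "A \<noteq> {}" and "\<And>I. I \<in> A \<Longrightarrow> ideal I R"
  shows "\<exists>I\<in>A. \<forall>J\<in>A. I \<subseteq> J \<longrightarrow> J = I"
proof (rule subset_Zorn_nonempty[OF assms(1)])
  fix C assume "C \<noteq> {}" and "subset.chain A C"
  then have "\<Union>C \<in> C"
    using assms(2) by (intro ideal_chain_is_trivial) (auto simp: subset_chain_def)
  with \<open>subset.chain A C\<close> show "\<Union>C \<in> A"
    by (auto simp: subset_chain_def)
qed

lemma (in module) ann_ideal:
  assumes "x \<in> carrier M"
  shows "ideal (ann R M x) R"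
proof (rule idealI)
  show "ring R" ..
  show "subgroup (ann R M x) (add_monoid R)"
    using assms
    by (intro R.add.subgroupI)
       (auto simp: ann_def smult_l_distr smult_l_minus simp flip: a_inv_def)
next
  fix a r assume "a \<in> ann R M x" and "r \<in> carrier R"
  then show "r \<otimes> a \<in> ann R M x" "a \<otimes> r \<in> ann R M x"
    using assms by (auto simp: ann_def smult_assoc1 R.m_comm[of a r])
qed

context
  fixes R :: "('a, 'r) ring_scheme"
    and M :: "('a, 'b, 'm) module_scheme" and N :: "('a, 'c, 'n) module_scheme"
    and f :: "'b \<Rightarrow> 'c"
  assumes M: "module R M" and N: "module R N" and f: "f \<in> lin_maps R M N"
begin

lemma lin_maps_closed: "x \<in> carrier M \<Longrightarrow> f x \<in> carrier N"
  using f by (auto simp: lin_maps_def hom_def)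

lemma lin_maps_add:
  "x \<in> carrier M \<Longrightarrow> y \<in> carrier M \<Longrightarrow> f (x \<oplus>\<^bsub>M\<^esub> y) = f x \<oplus>\<^bsub>N\<^esub> f y"
  using f by (auto simp: lin_maps_def hom_def)

lemma lin_maps_smult:
  "r \<in> carrier R \<Longrightarrow> x \<in> carrier M \<Longrightarrow> f (r \<odot>\<^bsub>M\<^esub> x) = r \<odot>\<^bsub>N\<^esub> f x"
  using f by (auto simp: lin_maps_def)

text \<open>Membership in \<open>hom\<close> only demands compatibility with addition, so the value
  at zero is obtained from linearity in the scalar 0.\<close>

lemma lin_maps_zero: "f \<zero>\<^bsub>M\<^esub> = \<zero>\<^bsub>N\<^esub>"
proof -
  interpret M: module R M by fact
  interpret N: module R N by fact
  have "f \<zero>\<^bsub>M\<^esub> = f (\<zero>\<^bsub>R\<^esub> \<odot>\<^bsub>M\<^esub> \<zero>\<^bsub>M\<^esub>)" by simp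
  also have "\<dots> = \<zero>\<^bsub>R\<^esub> \<odot>\<^bsub>N\<^esub> f \<zero>\<^bsub>M\<^esub>" by (rule lin_maps_smult) auto
  also have "\<dots> = \<zero>\<^bsub>N\<^esub>" by (simp add: lin_maps_closed)
  finally show ?thesis .
qed

lemma ann_lin_maps_mono:
  assumes "x \<in> carrier M"
  shows "ann R M x \<subseteq> ann R N (f x)"
  using assms lin_maps_smult[of _ x] lin_maps_zero by (force simp: ann_def)

lemma kernel_submodule: "submodule {x \<in> carrier M. f x = \<zero>\<^bsub>N\<^esub>} R M"
proof -
  interpret M: module R M by fact
  interpret N: module R N by fact
  \<comment> \<open>Negation is multiplication by the scalar -1.\<close>
  have minus: "f (\<ominus>\<^bsub>M\<^esub> x) = \<ominus>\<^bsub>N\<^esub> f x" if "x \<in> carrier M" for x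
    using that lin_maps_smult[of "\<ominus>\<^bsub>R\<^esub> \<one>\<^bsub>R\<^esub>" x]
    by (simp add: M.smult_l_minus N.smult_l_minus lin_maps_closed)
  show ?thesis
    by (rule M.submoduleI) (auto simp: lin_maps_zero lin_maps_add lin_maps_smult minus)
qed

end

lemma lin_maps_funpow:
  assumes "module R M" and f: "f \<in> lin_maps R M M"
  shows "f ^^ n \<in> lin_maps R M M"
  by (induction n) (use f in \<open>auto simp: lin_maps_def hom_def Pi_def\<close>)

text \<open>Finitely many generators need only finitely many exponents. Their maximum
  \<open>n\<close> works everywhere, since the kernel of \<open>f ^^ n\<close> is a submodule
  containing all generators.\<close>

lemma (in module) nilpotent_on_if_pointwise:
  assumes "fin_gen R M" and f: "f \<in> lin_maps R M M"
    and ptw: "\<And>x. x \<in> carrier M \<Longrightarrow> \<exists>k. (f ^^ k) x = \<zero>\<^bsub>M\<^esub>"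
  shows "nilpotent_on M f"
proof -
  obtain S where S: "finite S" "S \<subseteq> carrier M" and gen: "gen_submodule R M S = carrier M"
    using assms(1) by (auto simp: fin_gen_def)
  obtain k where k: "(f ^^ k x) x = \<zero>\<^bsub>M\<^esub>" if "x \<in> carrier M" for x
    using ptw by metis
  \<comment> \<open>For empty \<open>S\<close> this value is unspecified, which is harmless:
    \<open>n\<close> is compared with \<open>k x\<close> only for \<open>x\<close> in
    \<open>S\<close>.\<close>
  define n where "n = Max (k ` S)"
  define K where "K = {x \<in> carrier M. (f ^^ n) x = \<zero>\<^bsub>M\<^esub>}"
  have zero: "(f ^^ m) \<zero>\<^bsub>M\<^esub> = \<zero>\<^bsub>M\<^esub>" for m
    using lin_maps_zero module_axioms lin_maps_funpow[OF module_axioms f] by blast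
  have "S \<subseteq> K"
  proof
    fix x assume x: "x \<in> S"
    then have "n = (n - k x) + k x"
      \<comment> \<open>The subtraction is not truncated, because \<open>k x\<close> is at most the
        maximum \<open>n\<close>.\<close>
      using S by (simp add: n_def)
    then have "(f ^^ n) x = (f ^^ (n - k x)) ((f ^^ k x) x)"
      by (metis comp_apply funpow_add)
    with x S show "x \<in> K"
      by (auto simp: K_def k zero)
  qed
  moreover have "submodule K R M"
    unfolding K_def
    using kernel_submodule module_axioms lin_maps_funpow[OF module_axioms f] by blast
  ultimately have "carrier M \<subseteq> K"
    unfolding gen[symmetric] by (auto simp: gen_submodule_def)
  then show ?thesis
    by (auto simp: nilpotent_on_def K_def)
qed

text \<open>The last conclusion is what a factorization of \<open>f\<close> will exploit: any
  annihilator lying between those of \<open>z\<close> and \<open>f z\<close> must equal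
  both.\<close>

lemma non_nilpotent_imp_Ass:
  assumes "noetherian_ring R" and M: "module R M" and "fin_gen R M"
    and f: "f \<in> lin_maps R M M" and "\<not> nilpotent_on M f"
  obtains z where "z \<in> carrier M" and "primeideal (ann R M z) R"
    and "ann R M (f z) = ann R M z"
proof -
  interpret noetherian_ring R by fact
  interpret M: module R M by fact
  note pow = lin_maps_funpow[OF M f]
  note pow_closed = lin_maps_closed[OF M M pow]
  define Z where "Z = {z \<in> carrier M. \<forall>k. (f ^^ k) z \<noteq> \<zero>\<^bsub>M\<^esub>}"
  have "Z \<noteq> {}"
    using M.nilpotent_on_if_pointwise[OF \<open>fin_gen R M\<close> f] assms(5) by (auto simp: Z_def)
  then have "\<exists>I\<in>ann R M ` Z. \<forall>J\<in>ann R M ` Z. I \<subseteq> J \<longrightarrow> J = I"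
    by (intro ideals_have_maximal) (auto simp: Z_def M.ann_ideal)
  then obtain z where "z \<in> Z"
    and max: "\<And>y. y \<in> Z \<Longrightarrow> ann R M z \<subseteq> ann R M y \<Longrightarrow> ann R M y = ann R M z"
    by auto
  then have z: "z \<in> carrier M" and nz: "(f ^^ k) z \<noteq> \<zero>\<^bsub>M\<^esub>" for k
    by (auto simp: Z_def)
  \<comment> \<open>Applying \<open>f\<close> another j times gives \<open>f ^^ (j + k)\<close> at
    \<open>z\<close>, which is nonzero.\<close>
  have "(f ^^ k) z \<in> Z" for k
    using nz[of "_ + k"] by (auto simp: Z_def funpow_add pow_closed z)
  then have stable: "ann R M ((f ^^ k) z) = ann R M z" for k
    using ann_lin_maps_mono[OF M M pow z] by (intro max)
  have "primeideal (ann R M z) R"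
  proof (rule primeidealI)
    show "ideal (ann R M z) R" by (rule M.ann_ideal[OF z])
    show "cring R" by (rule M.R.is_cring)
    \<comment> \<open>The instance k = 0 of \<open>nz\<close> says that \<open>z\<close> itself is
      nonzero.\<close>
    have "\<one>\<^bsub>R\<^esub> \<notin> ann R M z"
      using nz[of 0] z by (simp add: ann_def)
    then show "carrier R \<noteq> ann R M z" by auto
  next
    fix a b assume a: "a \<in> carrier R" and b: "b \<in> carrier R" and ab: "a \<otimes>\<^bsub>R\<^esub> b \<in> ann R M z"
    show "a \<in> ann R M z \<or> b \<in> ann R M z"
    \<comment> \<open>If bz is in \<open>Z\<close>, maximality gives Ann(bz) = Ann z, and a kills
      bz. Otherwise some power of \<open>f\<close> kills bz, so b annihilates an iterate of
      \<open>z\<close> and hence, by \<open>stable\<close>, \<open>z\<close> itself.\<close>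
    proof (cases "b \<odot>\<^bsub>M\<^esub> z \<in> Z")
      case True
      \<comment> \<open>Commutativity, in the form r(bz) = b(rz), supplies the inclusion of Ann z in
        Ann(bz) that \<open>max\<close> requires.\<close>
      have "r \<odot>\<^bsub>M\<^esub> (b \<odot>\<^bsub>M\<^esub> z) = \<zero>\<^bsub>M\<^esub>" if "r \<in> carrier R" "r \<odot>\<^bsub>M\<^esub> z = \<zero>\<^bsub>M\<^esub>" for r
        using that b z M.smult_assoc1[of r b z] M.smult_assoc1[of b r z] M.R.m_comm[of r b]
        by simp
      with True have "ann R M (b \<odot>\<^bsub>M\<^esub> z) = ann R M z"
        by (intro max) (auto simp: ann_def)
      moreover have "a \<in> ann R M (b \<odot>\<^bsub>M\<^esub> z)"
        using a b z ab by (simp add: ann_def M.smult_assoc1)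
      ultimately show ?thesis by simp
    next
      case False
      then obtain k where "(f ^^ k) (b \<odot>\<^bsub>M\<^esub> z) = \<zero>\<^bsub>M\<^esub>"
        using b z by (auto simp: Z_def)
      then have "b \<in> ann R M ((f ^^ k) z)"
        using b by (simp add: ann_def lin_maps_smult[OF M M pow] z)
      then show ?thesis by (simp add: stable)
    qed
  qed
  then show thesis
    using that z stable[of 1] by simp
qed

theorem mainTheorem2:
  fixes R :: "('a, 'r) ring_scheme"
    and M :: "('a, 'b, 'm) module_scheme"
    and N :: "('a, 'c, 'n) module_scheme"
    and f :: "'b \<Rightarrow> 'b" and g :: "'b \<Rightarrow> 'c" and h :: "'c \<Rightarrow> 'b"
  assumes "cring R" and "noetherian_ring R" and "krull_dim R < \<infinity>"
    and "module R M" and "fin_gen R M"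
    and "module R N" and "fin_gen R N"
    and "f \<in> lin_maps R M M"
    and "g \<in> lin_maps R M N" and "h \<in> lin_maps R N M"
    and "\<And>x. x \<in> carrier M \<Longrightarrow> f x = h (g x)"
    and "Ass R M \<inter> Ass R N = {}"
  shows "nilpotent_on M f"
proof (rule ccontr)
  assume "\<not> nilpotent_on M f"
  then obtain z where z: "z \<in> carrier M" and prime: "primeideal (ann R M z) R"
    and ann_f: "ann R M (f z) = ann R M z"
    using non_nilpotent_imp_Ass assms(2,4,5,8) by blast
  have gz: "g z \<in> carrier N"
    by (rule lin_maps_closed[OF assms(4,6,9) z])
  have "ann R M z \<subseteq> ann R N (g z)"
    by (rule ann_lin_maps_mono[OF assms(4,6,9) z])
  moreover have "ann R N (g z) \<subseteq> ann R M (f z)"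
    unfolding assms(11)[OF z] by (rule ann_lin_maps_mono[OF assms(6,4,10) gz])
  \<comment> \<open>Both ends of the chain of inclusions agree by \<open>ann_f\<close>, so
    \<open>z\<close> and \<open>g z\<close> witness the same prime in \<open>Ass R M\<close> and
    \<open>Ass R N\<close>.\<close>
  ultimately have "ann R M z = ann R N (g z)"
    using ann_f by simp
  with prime z gz have "ann R M z \<in> Ass R M \<inter> Ass R N"
    by (auto simp: Ass_def)
  with assms(12) show False by simp
qed

end
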